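(* Let $a,b,c,d\ge0$, not all zero, with $a+c=b+d$, and put $p=\frac a{a+c}$, $r=\frac b{b+d}$, $\lambda(p,r)=\max(|1-2p|,|1-2r|)$. For every $i\in\mathbb Z$: - if $a=d$ and $b=c$ (i.e. $p+r=1$), then for every $t\in\mathbb N$, $C_8(i,t)=0$ if $i\ne0$, and $C_8(0,t)=(1-2p)^t$; - otherwise, as $t\to\infty$, $$C_8(i,t)=O\left(\frac{\lambda(p,r)^t}{\sqrt t}\right).$$
   Context: $\mathbb N=\{0,1,2,\dots\}$; $0^0=1$. $\mathrm{PM}(1/2)$ is the law on $\{0,1\}^{\mathbb Z}$ of i.i.d. Bernoulli$(1/2)$ variables indexed by $\mathbb Z$. The law $\mathcal L(\mu;p,r)$, for $\mu$ a probability measure on $\{0,1\}^{\mathbb Z}$ and $p,r\in[0,1]$, is the law of the random field $(e(i,t))_{i\in\mathbb Z,t\in\mathbb N}\in\{0,1\}^{\mathbb Z\times\mathbb N}$ such that $(e(i,0))_{i\in\mathbb Z}\sim\mu$ and $(e(\cdot,t))_{t\ge0}$ is a Markov chain such that, given line $t$, independently for all $i\in\mathbb Z$ with $i+t$ even, the pair $(e(i,t+1),e(i+1,t+1))$ depends only on $(e(i,t),e(i+1,t))$, with, for $k\in\{0,1\}$: $(k,k)\mapsto(k,k)$ with probability $r$ and $(k,k)\mapsto(1-k,1-k)$ with probability $1-r$; $(k,1-k)\mapsto(1-k,k)$ with probability $p$ and $(k,1-k)\mapsto(k,1-k)$ with probability $1-p$. The edge correlation function of the 8-vertex model with free boundary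 condition and $a+c=b+d$ is, for $(e(i,t))\sim\overline P^8_\infty=\mathcal L\left(\mathrm{PM}(1/2);\frac{a}{a+c},\frac{b}{b+d}\right)$, $$C_8(i,t)=\frac{\mathrm{Cov}(e(0,0),e(i,t))}{\sqrt{\mathrm{Var}(e(0,0))}\sqrt{\mathrm{Var}(e(i,t))}}.$$ *)

theory Defs
  imports "HOL-Probability.Probability" "HOL-Library.Landau_Symbols"
begin

text \<open>Edge states are booleans, \<^const>\<open>True\<close> standing for 1 and \<^const>\<open>False\<close> for 0.
  A line is a function \<^typ>\<open>int \<Rightarrow> bool\<close>, a field a function \<^typ>\<open>int \<times> nat \<Rightarrow> bool\<close>;
  both carry the product sigma-algebra.\<close>

abbreviation line_space :: "(int \<Rightarrow> bool) measure" where
  "line_space \<equiv> PiM UNIV (\<lambda>_. count_space UNIV)"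

abbreviation field_space :: "(int \<times> nat \<Rightarrow> bool) measure" where
  "field_space \<equiv> PiM UNIV (\<lambda>_. count_space UNIV)"

definition PM :: "real \<Rightarrow> (int \<Rightarrow> bool) measure" where
  "PM q = PiM UNIV (\<lambda>_. measure_pmf (bernoulli_pmf q))"

text \<open>Only meant for \<open>p, r \<in> [0, 1]\<close>: \<^const>\<open>bernoulli_pmf\<close> clamps its argument to that interval.\<close>

definition pair_step :: "real \<Rightarrow> real \<Rightarrow> bool \<Rightarrow> bool \<Rightarrow> (bool \<times> bool) pmf" where
  "pair_step p r x y =
    (if x = y
     then map_pmf (\<lambda>keep. if keep then (x, y) else (\<not> x, \<not> y)) (bernoulli_pmf r)
     else map_pmf (\<lambda>swap. if swap then (y, x) else (x, y)) (bernoulli_pmf p))"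

text \<open>The law of line \<open>t + 1\<close> given line \<open>t\<close>. The product is over the pairs \<open>(i, i + 1)\<close> with
  \<open>i + t\<close> even, indexed by their left end \<open>i\<close>.\<close>

definition line_step :: "real \<Rightarrow> real \<Rightarrow> nat \<Rightarrow> (int \<Rightarrow> bool) \<Rightarrow> (int \<Rightarrow> bool) measure" where
  "line_step p r t \<eta> =
    distr (PiM {i. even (i + int t)} (\<lambda>i. measure_pmf (pair_step p r (\<eta> i) (\<eta> (i + 1)))))
      line_space
      (\<lambda>\<omega> i. if even (i + int t) then fst (\<omega> i) else snd (\<omega> (i - 1)))"

text \<open>The conditional law of line \<open>t\<close> given the lines \<open>0, \<dots>, t - 1\<close>.\<close>

definition chain_kernel ::
    "(int \<Rightarrow> bool) measure \<Rightarrow> real \<Rightarrow> real \<Rightarrow> nat \<Rightarrow> (nat \<Rightarrow> int \<Rightarrow> bool) \<Rightarrow> (int \<Rightarrow> bool) measure" where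
  "chain_kernel \<mu> p r t h = (case t of 0 \<Rightarrow> \<mu> | Suc s \<Rightarrow> line_step p r s (h s))"

text \<open>The law of the whole chain, by the theorem of Ionescu-Tulcea; this is the measure \<open>PF.lim\<close>
  of the locale \<^locale>\<open>Ionescu_Tulcea\<close>, whose assumptions hold by
  \<open>Ionescu_Tulcea_chain_kernel\<close> below.\<close>

definition chain_law ::
    "(int \<Rightarrow> bool) measure \<Rightarrow> real \<Rightarrow> real \<Rightarrow> (nat \<Rightarrow> int \<Rightarrow> bool) measure" where
  "chain_law \<mu> p r =
    projective_family.lim UNIV (Ionescu_Tulcea.CI (chain_kernel \<mu> p r) (\<lambda>_. line_space))
      (\<lambda>_. line_space)"

definition field_law ::
    "(int \<Rightarrow> bool) measure \<Rightarrow> real \<Rightarrow> real \<Rightarrow> (int \<times> nat \<Rightarrow> bool) measure" where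
  "field_law \<mu> p r = distr (chain_law \<mu> p r) field_space (\<lambda>h (i, t). h t i)"

definition edge :: "int \<Rightarrow> nat \<Rightarrow> (int \<times> nat \<Rightarrow> bool) \<Rightarrow> real" where
  "edge i t e = of_bool (e (i, t))"

definition covariance :: "'a measure \<Rightarrow> ('a \<Rightarrow> real) \<Rightarrow> ('a \<Rightarrow> real) \<Rightarrow> real" where
  "covariance M X Y =
    prob_space.expectation M (\<lambda>\<omega>. (X \<omega> - prob_space.expectation M X) * (Y \<omega> - prob_space.expectation M Y))"

definition P8 :: "real \<Rightarrow> real \<Rightarrow> real \<Rightarrow> real \<Rightarrow> (int \<times> nat \<Rightarrow> bool) measure" where
  "P8 a b c d = field_law (PM (1/2)) (a / (a + c)) (b / (b + d))"

definition C8 :: "real \<Rightarrow> real \<Rightarrow> real \<Rightarrow> real \<Rightarrow> int \<Rightarrow> nat \<Rightarrow> real" where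
  "C8 a b c d i t =
    covariance (P8 a b c d) (edge 0 0) (edge i t) /
      (sqrt (prob_space.variance (P8 a b c d) (edge 0 0)) *
       sqrt (prob_space.variance (P8 a b c d) (edge i t)))"

definition decay_rate :: "real \<Rightarrow> real \<Rightarrow> real" where
  "decay_rate p r = max \<bar>1 - 2 * p\<bar> \<bar>1 - 2 * r\<bar>"


lemma PM_in_prob_algebra: "PM q \<in> space (prob_algebra line_space)"
proof -
  have "prob_space (PM q)"
    unfolding PM_def by (intro prob_space_PiM prob_space_measure_pmf)
  moreover have "sets (PM q) = sets line_space"
    unfolding PM_def by (intro sets_PiM_cong) auto
  ultimately show ?thesis
    by (simp add: space_prob_algebra)
qed

lemma measurable_emeasure_pair_step [measurable]:
  "(\<lambda>\<eta>. emeasure (measure_pmf (pair_step p r (\<eta> i) (\<eta> j))) A) \<in> borel_measurable line_space"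
proof -
  have "(\<lambda>\<eta>. (\<eta> i, \<eta> j)) \<in> measurable line_space (count_space UNIV)"
    by simp
  then have "(\<lambda>\<eta>. (\<lambda>(x, y). emeasure (measure_pmf (pair_step p r x y)) A) (\<eta> i, \<eta> j))
      \<in> borel_measurable line_space"
    by (rule measurable_compose) simp
  then show ?thesis by simp
qed

lemma measurable_line_step [measurable]:
  "line_step p r t \<in> measurable line_space (prob_algebra line_space)"
proof -
  define I where "I = {i. even (i + int t)}"
  define K where "K \<eta> = PiM I (\<lambda>i. measure_pmf (pair_step p r (\<eta> i) (\<eta> (i + 1))))" for \<eta>
  define N :: "(int \<Rightarrow> bool \<times> bool) measure" where "N = PiM I (\<lambda>_. count_space UNIV)"
  have "K \<in> measurable line_space (prob_algebra N)"
  proof (rule measurable_prob_algebra_generated[where \<Omega> = "\<Pi>\<^sub>E i\<in>I. UNIV"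
        and G = "prod_algebra I (\<lambda>_. count_space UNIV)"])
    show "sets N = sigma_sets (\<Pi>\<^sub>E i\<in>I. UNIV) (prod_algebra I (\<lambda>_. count_space UNIV))"
      by (simp add: N_def sets_PiM)
    show "Int_stable (prod_algebra I (\<lambda>_. count_space UNIV))"
      by (rule Int_stable_prod_algebra)
    show "prod_algebra I (\<lambda>_. count_space UNIV) \<subseteq> Pow (\<Pi>\<^sub>E i\<in>I. UNIV)"
      using prod_algebra_sets_into_space[of I "\<lambda>_. count_space UNIV"] by simp
    show "prob_space (K \<eta>)" for \<eta>
      unfolding K_def by (intro prob_space_PiM prob_space_measure_pmf)
    show "sets (K \<eta>) = sets N" for \<eta>
      unfolding K_def N_def by (intro sets_PiM_cong) auto
    fix A :: "(int \<Rightarrow> bool \<times> bool) set"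
    assume "A \<in> prod_algebra I (\<lambda>_. count_space UNIV)"
    then obtain J E where A: "A = prod_emb I (\<lambda>_. count_space UNIV) J (Pi\<^sub>E J E)"
      and J: "finite J" "J \<subseteq> I"
      by (rule prod_algebraE)
    have "emeasure (K \<eta>) A =
        (\<Prod>i\<in>J. emeasure (measure_pmf (pair_step p r (\<eta> i) (\<eta> (i + 1)))) (E i))" for \<eta>
    proof -
      have "A = prod_emb I (\<lambda>i. measure_pmf (pair_step p r (\<eta> i) (\<eta> (i + 1)))) J (Pi\<^sub>E J E)"
        by (simp add: A prod_emb_def)
      then show ?thesis
        unfolding K_def using J
        by (simp add: emeasure_PiM_emb prob_space_measure_pmf)
    qed
    then show "(\<lambda>\<eta>. emeasure (K \<eta>) A) \<in> borel_measurable line_space"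
      by simp
  qed
  moreover have "(\<lambda>\<omega> i. if even (i + int t) then fst (\<omega> i) else snd (\<omega> (i - 1)))
      \<in> measurable N line_space"
  proof (rule measurable_PiM_single')
    fix i :: int
    show "(\<lambda>\<omega>. if even (i + int t) then fst (\<omega> i) else snd (\<omega> (i - 1)))
        \<in> measurable N (count_space UNIV)"
    proof (cases "even (i + int t)")
      case True
      then have "(\<lambda>\<omega>. \<omega> i) \<in> measurable N (count_space UNIV)"
        unfolding N_def by (intro measurable_component_singleton) (simp add: I_def)
      then have "(\<lambda>\<omega>. fst (\<omega> i)) \<in> measurable N (count_space UNIV)"
        by (rule measurable_compose) simp
      with True show ?thesis by simp
    next
      case False
      then have "(\<lambda>\<omega>. \<omega> (i - 1)) \<in> measurable N (count_space UNIV)"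
        unfolding N_def by (intro measurable_component_singleton) (simp add: I_def)
      then have "(\<lambda>\<omega>. snd (\<omega> (i - 1))) \<in> measurable N (count_space UNIV)"
        by (rule measurable_compose) simp
      with False show ?thesis by simp
    qed
  qed auto
  ultimately show ?thesis
    unfolding line_step_def K_def I_def
    by (rule measurable_compose[OF _ measurable_distr_prob_space])
qed

lemma measurable_chain_kernel:
  assumes "\<mu> \<in> space (prob_algebra line_space)"
  shows "chain_kernel \<mu> p r t \<in> measurable (PiM {0..<t} (\<lambda>_. line_space)) (prob_algebra line_space)"
proof (cases t)
  case 0
  then have "chain_kernel \<mu> p r t = (\<lambda>_. \<mu>)"
    by (simp add: chain_kernel_def fun_eq_iff)
  with assms show ?thesis
    by simp
next
  case (Suc s)
  have "(\<lambda>h. h s) \<in> measurable (PiM {0..<t} (\<lambda>_. line_space)) line_space"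
    by (intro measurable_component_singleton) (simp add: Suc)
  then have "(\<lambda>h. line_step p r s (h s)) \<in>
      measurable (PiM {0..<t} (\<lambda>_. line_space)) (prob_algebra line_space)"
    by (rule measurable_compose) simp
  moreover have "chain_kernel \<mu> p r t = (\<lambda>h. line_step p r s (h s))"
    by (simp add: Suc chain_kernel_def fun_eq_iff)
  ultimately show ?thesis
    by simp
qed

lemma Ionescu_Tulcea_chain_kernel:
  assumes "\<mu> \<in> space (prob_algebra line_space)"
  shows "Ionescu_Tulcea (chain_kernel \<mu> p r) (\<lambda>_. line_space)"
proof (rule Ionescu_Tulcea.intro)
  fix t
  note K = measurable_chain_kernel[OF assms, of p r t]
  show "chain_kernel \<mu> p r t \<in> measurable (PiM {0..<t} (\<lambda>_. line_space)) (subprob_algebra line_space)"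
    using K by (rule measurable_prob_algebraD)
  fix h
  assume "h \<in> space (PiM {0..<t} (\<lambda>_. line_space))"
  then show "prob_space (chain_kernel \<mu> p r t h)"
    using measurable_space[OF K] by (simp add: space_prob_algebra)
qed

lemma prob_space_chain_law:
  assumes "\<mu> \<in> space (prob_algebra line_space)"
  shows "prob_space (chain_law \<mu> p r)"
proof -
  interpret IT: Ionescu_Tulcea "chain_kernel \<mu> p r" "\<lambda>_. line_space"
    by (rule Ionescu_Tulcea_chain_kernel[OF assms])
  have "prob_space (distr IT.PF.lim (PiM {} (\<lambda>_. line_space)) (\<lambda>x. restrict x {}))"
    unfolding IT.distr_lim[OF finite.emptyI] by (rule IT.PF.prob_space_P) auto
  moreover have "(\<lambda>x. restrict x {}) \<in> measurable IT.PF.lim (PiM {} (\<lambda>_. line_space))"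
    by (simp add: measurable_cong_sets[OF IT.PF.sets_lim refl] measurable_restrict_subset)
  ultimately show ?thesis
    unfolding chain_law_def using prob_space_distrD by blast
qed

lemma prob_space_P8: "prob_space (P8 a b c d)"
proof -
  let ?L = "chain_law (PM (1/2)) (a / (a + c)) (b / (b + d))"
  interpret IT: Ionescu_Tulcea "chain_kernel (PM (1/2)) (a / (a + c)) (b / (b + d))" "\<lambda>_. line_space"
    by (rule Ionescu_Tulcea_chain_kernel[OF PM_in_prob_algebra])
  have sets_L: "sets ?L = sets (PiM UNIV (\<lambda>_. line_space))"
    unfolding chain_law_def by (rule IT.PF.sets_lim)
  have "(\<lambda>h (i, t). h t i) \<in> measurable (PiM UNIV (\<lambda>_::nat. line_space)) field_space"
  proof (rule measurable_PiM_single')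
    fix it :: "int \<times> nat"
    obtain i t where it: "it = (i, t)"
      by fastforce
    have "(\<lambda>h. h t) \<in> measurable (PiM UNIV (\<lambda>_::nat. line_space)) line_space"
      by (rule measurable_component_singleton) simp
    then have "(\<lambda>h. h t i) \<in> measurable (PiM UNIV (\<lambda>_::nat. line_space)) (count_space UNIV)"
      by (rule measurable_compose) (rule measurable_component_singleton, simp)
    then show "(\<lambda>h. case it of (i, t) \<Rightarrow> h t i) \<in>
        measurable (PiM UNIV (\<lambda>_::nat. line_space)) (count_space UNIV)"
      by (simp add: it)
  qed auto
  then have "(\<lambda>h (i, t). h t i) \<in> measurable ?L field_space"
    by (simp add: measurable_cong_sets[OF sets_L refl])
  then show ?thesis
    unfolding P8_def field_law_def
    by (intro prob_space.prob_space_distr prob_space_chain_law PM_in_prob_algebra)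
qed

end

theory Submission
  imports Defs
begin

text \<open>
  In spins \<open>\<plusminus>1\<close> the local rule is linear in conditional mean: with \<open>\<alpha> = r - p\<close> and
  \<open>\<beta> = r + p - 1\<close>, the expected new spin of a site is \<open>\<alpha>\<close> times its old spin plus \<open>\<beta>\<close> times the
  old spin of its partner. Hence \<open>C\<^sub>8\<close> solves a linear recursion started from the unit mass at \<open>0\<close>,
  which is solved by inspection when \<open>\<alpha> = 0\<close> or \<open>\<beta> = 0\<close>. Otherwise \<open>\<bar>\<alpha>\<bar> + \<bar>\<beta>\<bar>\<close> is the decay rate,
  and after normalisation \<open>\<bar>\<alpha>\<bar>\<close>, \<open>\<bar>\<beta>\<bar>\<close> are the probabilities that a persistent random walk reverses or
  keeps its direction. Cut time into blocks of two steps. A mixed block (one step of each kind) shifts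
  the walk by \<open>+1\<close> or \<open>-1\<close> with equal probability, while the shift of any other block depends only on
  the direction. So, given the kind of each block, the position is a deterministic
  shift of a simple random walk with \<open>k\<close> steps, of maximal probability at most \<open>1 / sqrt (k + 1)\<close>; and \<open>k\<close>
  is binomial with mean of order \<open>t\<close>.
\<close>

section \<open>The correlation recursion\<close>

text \<open>The other member of the pair in which site \<open>i\<close> is updated between times
  \<open>t\<close> and \<open>t + 1\<close>; left ends are the sites with \<open>i + t\<close> even,
  as in \<open>line_step\<close>.\<close>

definition partner :: "nat \<Rightarrow> int \<Rightarrow> int" where
  "partner t i = (if even (i + int t) then i + 1 else i - 1)"

definition unit_mass :: "int \<Rightarrow> real" where
  "unit_mass i = of_bool (i = 0)"

text \<open>The coefficients are free reals rather than functions of \<open>p\<close> and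
  \<open>r\<close>, so that \<open>abs_corr_le\<close> can pass to their absolute values.\<close>

primrec corr :: "real \<Rightarrow> real \<Rightarrow> nat \<Rightarrow> int \<Rightarrow> real" where
  "corr \<alpha> \<beta> 0 = unit_mass"
| "corr \<alpha> \<beta> (Suc t) = (\<lambda>i. \<alpha> * corr \<alpha> \<beta> t i + \<beta> * corr \<alpha> \<beta> t (partner t i))"

text \<open>Two steps of the recursion, from an even time to the next one; sites of even index have their
  partner on the right at even times.\<close>

definition two_step :: "real \<Rightarrow> real \<Rightarrow> (int \<Rightarrow> real) \<Rightarrow> int \<Rightarrow> real" where
  "two_step \<alpha> \<beta> g i =
    \<alpha>\<^sup>2 * g i + \<alpha> * \<beta> * (g (i + 1) + g (i - 1)) + \<beta>\<^sup>2 * g (if even i then i - 2 else i + 2)"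

definition avg :: "(int \<Rightarrow> real) \<Rightarrow> int \<Rightarrow> real" where
  "avg g i = (g (i + 1) + g (i - 1)) / 2"

text \<open>\<open>g\<close> stays a function on all integers, so translations and
  \<open>avg\<close> can act on it regardless of parity; only the truncation records the
  class.\<close>

definition on_parity :: "bool \<Rightarrow> (int \<Rightarrow> real) \<Rightarrow> int \<Rightarrow> real" where
  "on_parity s g i = (if even i = s then g i else 0)"

lemma corr_no_exchange: "corr \<alpha> 0 t i = (if i = 0 then \<alpha> ^ t else 0)"
  by (induction t) (auto simp: unit_mass_def)

text \<open>Mass at a left end moves to the right end of its pair, which is a left end again at the
  next time; so it travels right at unit speed.\<close>

lemma corr_pure_exchange: "corr 0 \<beta> t i = (if i = int t then \<beta> ^ t else 0)"
proof (induction t arbitrary: i)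
  case (Suc t)
  have "partner t i = int t \<longleftrightarrow> i = int (Suc t)"
    unfolding partner_def by (auto split: if_splits; presburger)
  then show ?case by (simp add: Suc.IH)
qed (simp add: unit_mass_def)

lemma abs_corr_le: "\<bar>corr \<alpha> \<beta> t i\<bar> \<le> corr \<bar>\<alpha>\<bar> \<bar>\<beta>\<bar> t i"
proof (induction t arbitrary: i)
  case (Suc t)
  have "\<bar>corr \<alpha> \<beta> (Suc t) i\<bar> \<le> \<bar>\<alpha> * corr \<alpha> \<beta> t i\<bar> + \<bar>\<beta> * corr \<alpha> \<beta> t (partner t i)\<bar>"
    by simp
  also have "\<dots> \<le> corr \<bar>\<alpha>\<bar> \<bar>\<beta>\<bar> (Suc t) i"
    by (simp add: abs_mult add_mono mult_left_mono Suc.IH)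
  finally show ?case .
qed (simp add: unit_mass_def)

lemma corr_even: "corr \<alpha> \<beta> (2 * n) = (two_step \<alpha> \<beta> ^^ n) unit_mass"
proof (induction n)
  case (Suc n)
  \<comment> \<open>One exchange reads \<open>i + 1\<close> or \<open>i - 1\<close>, depending on
    which of the two steps exchanges; two exchanges shift by 2 in a direction fixed by the parity of
    \<open>i\<close>.\<close>
  have "corr \<alpha> \<beta> (2 * Suc n) = two_step \<alpha> \<beta> (corr \<alpha> \<beta> (2 * n))"
    by (rule ext) (simp add: two_step_def partner_def power2_eq_square algebra_simps)
  with Suc show ?case by simp
qed simp

lemma two_step_pow_add:
  "(two_step \<alpha> \<beta> ^^ n) (\<lambda>x. f x + g x) =
    (\<lambda>x. (two_step \<alpha> \<beta> ^^ n) f x + (two_step \<alpha> \<beta> ^^ n) g x)"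
  by (induction n) (simp_all add: two_step_def fun_eq_iff algebra_simps)

lemma two_step_pow_scale:
  "(two_step \<alpha> \<beta> ^^ n) (\<lambda>x. c * f x) = (\<lambda>x. c * (two_step \<alpha> \<beta> ^^ n) f x)"
  by (induction n) (simp_all add: two_step_def fun_eq_iff algebra_simps)

text \<open>On functions living on one parity class the \<open>\<beta>\<^sup>2\<close> term is a plain translation, which commutes
  with \<^const>\<open>avg\<close>.\<close>

lemma two_step_on_parity:
  "two_step \<alpha> \<beta> (on_parity s g) =
    (\<lambda>x. \<alpha>\<^sup>2 * on_parity s g x + \<beta>\<^sup>2 * on_parity s (\<lambda>y. g (y + (if s then - 2 else 2))) x
      + 2 * \<alpha> * \<beta> * on_parity (\<not> s) (avg g) x)"
  by (rule ext) (auto simp: two_step_def on_parity_def avg_def)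

lemma avg_pow_shift: "(avg ^^ k) (\<lambda>y. g (y + c)) = (\<lambda>y. (avg ^^ k) g (y + c))"
proof (induction k)
  case (Suc k)
  then show ?case by (simp add: avg_def fun_eq_iff algebra_simps)
qed simp

text \<open>Pascal's rule, read as conditioning on the first of \<open>n + 1\<close> trials: failure
  has weight \<open>A\<close> and leaves the count alone, success has weight \<open>B\<close> and
  raises it by one.\<close>

lemma binomial_average_Suc:
  fixes A B :: real
  shows "(\<Sum>k\<le>Suc n. real (Suc n choose k) * B ^ k * A ^ (Suc n - k) * m k) =
    A * (\<Sum>k\<le>n. real (n choose k) * B ^ k * A ^ (n - k) * m k) +
    B * (\<Sum>k\<le>n. real (n choose k) * B ^ k * A ^ (n - k) * m (Suc k))"
proof -
  have *: "A * (\<Sum>k\<le>n. real (n choose k) * B ^ k * A ^ (n - k) * m k) =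
      (\<Sum>k\<le>Suc n. real (n choose k) * B ^ k * A ^ (Suc n - k) * m k)"
    by (simp add: sum_distrib_left binomial_eq_0) (rule sum.cong, simp_all add: Suc_diff_le)
  show ?thesis
    unfolding * sum.atMost_Suc_shift
    by (simp add: sum_distrib_left sum.distrib[symmetric] algebra_simps)
qed

lemma abs_combination_le:
  fixes a b c u v w :: real
  assumes "a \<ge> 0" "b \<ge> 0" "c \<ge> 0"
  shows "\<bar>a * u + b * v + c * w\<bar> \<le> a * \<bar>u\<bar> + b * \<bar>v\<bar> + c * \<bar>w\<bar>"
proof -
  have "a * \<bar>u\<bar> = \<bar>a * u\<bar>" "b * \<bar>v\<bar> = \<bar>b * v\<bar>" "c * \<bar>w\<bar> = \<bar>c * w\<bar>"
    using assms by (simp_all add: abs_mult)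
  then show ?thesis by linarith
qed

text \<open>Here \<open>k\<close> counts the mixed blocks, each contributing weight
  \<open>2 * \<alpha> * \<beta>\<close> and one \<open>avg\<close>. The bound \<open>m k\<close> is
  uniform in position, so the translations made by the other blocks cost nothing.\<close>

lemma two_step_pow_bound:
  assumes "\<alpha> \<ge> 0" "\<beta> \<ge> 0" and "\<And>k x. \<bar>(avg ^^ k) g x\<bar> \<le> m k"
  shows "\<bar>(two_step \<alpha> \<beta> ^^ n) (on_parity s g) x\<bar> \<le>
    (\<Sum>k\<le>n. real (n choose k) * (2 * \<alpha> * \<beta>) ^ k * (\<alpha>\<^sup>2 + \<beta>\<^sup>2) ^ (n - k) * m k)"
  using assms(3)
\<comment> \<open>\<open>m\<close> varies along with \<open>g\<close> and \<open>s\<close>: a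
  translated \<open>g\<close> keeps the bound \<open>m\<close>, whereas \<open>avg g\<close> obeys
  the shifted bound \<open>\<lambda>k. m (Suc k)\<close>.\<close>
proof (induction n arbitrary: g s m)
  case 0
  from 0[of 0 x] show ?case by (auto simp: on_parity_def)
next
  case (Suc n)
  let ?T = "two_step \<alpha> \<beta> ^^ n"
  let ?S = "\<lambda>m. \<Sum>k\<le>n. real (n choose k) * (2 * \<alpha> * \<beta>) ^ k * (\<alpha>\<^sup>2 + \<beta>\<^sup>2) ^ (n - k) * m k"
  let ?c = "if s then - 2 else 2 :: int"
  have shift: "\<bar>(avg ^^ k) (\<lambda>y. g (y + ?c)) x\<bar> \<le> m k" for k x
    using Suc.prems[of k "x + ?c"] by (subst avg_pow_shift)
  have smooth: "\<bar>(avg ^^ k) (avg g) x\<bar> \<le> m (Suc k)" for k x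
    using Suc.prems[of "Suc k" x] by (simp only: funpow_Suc_right o_apply)
  have "\<bar>(two_step \<alpha> \<beta> ^^ Suc n) (on_parity s g) x\<bar> =
      \<bar>\<alpha>\<^sup>2 * ?T (on_parity s g) x + \<beta>\<^sup>2 * ?T (on_parity s (\<lambda>y. g (y + ?c))) x
      + 2 * \<alpha> * \<beta> * ?T (on_parity (\<not> s) (avg g)) x\<bar>"
    by (simp only: funpow_Suc_right o_apply two_step_on_parity two_step_pow_add two_step_pow_scale)
  also have "\<dots> \<le> \<alpha>\<^sup>2 * \<bar>?T (on_parity s g) x\<bar> + \<beta>\<^sup>2 * \<bar>?T (on_parity s (\<lambda>y. g (y + ?c))) x\<bar>
      + 2 * \<alpha> * \<beta> * \<bar>?T (on_parity (\<not> s) (avg g)) x\<bar>"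
    using assms(1,2) by (intro abs_combination_le) simp_all
  also have "\<dots> \<le> \<alpha>\<^sup>2 * ?S m + \<beta>\<^sup>2 * ?S m + 2 * \<alpha> * \<beta> * ?S (\<lambda>k. m (Suc k))"
    using assms(1,2)
    by (intro add_mono mult_left_mono Suc.IH[OF Suc.prems] Suc.IH[OF shift] Suc.IH[OF smooth]) simp_all
  also have "\<dots> = (\<Sum>k\<le>Suc n. real (Suc n choose k) * (2 * \<alpha> * \<beta>) ^ k *
      (\<alpha>\<^sup>2 + \<beta>\<^sup>2) ^ (Suc n - k) * m k)"
    by (simp only: binomial_average_Suc distrib_right)
  finally show ?case .
qed

section \<open>Square root decay\<close>

lemma central_binomial_Suc:
  "Suc n * ((2 * Suc n) choose Suc n) = 2 * Suc (2 * n) * ((2 * n) choose n)"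
proof -
  have "Suc (2 * n) choose n = Suc (2 * n) choose Suc n"
    by (subst binomial_symmetric) simp_all
  with Suc_times_binomial_eq[of "2 * n" n]
  have "Suc n * (Suc (2 * n) choose n) = Suc (2 * n) * ((2 * n) choose n)"
    by (simp only: mult.commute)
  moreover have "Suc n * ((2 * Suc n) choose Suc n) = 2 * (Suc n * (Suc (2 * n) choose n))"
  proof -
    have "Suc (Suc (2 * n)) = 2 * Suc n" by simp
    with Suc_times_binomial_eq[of "Suc (2 * n)" n] show ?thesis
      by (simp only: mult_ac)
  qed
  ultimately show ?thesis by (simp only: mult.assoc)
qed

text \<open>Squared and multiplied by \<open>2 * n + 1\<close>, the left side is 1 at
  \<open>n = 0\<close>. Each increment of \<open>n\<close> multiplies it by (2n+1)(2n+3)/(2n+2)^2,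
  which is at most 1.\<close>

lemma central_binomial_le: "real ((2 * n) choose n) / 4 ^ n \<le> 1 / sqrt (2 * real n + 1)"
proof -
  have "(real ((2 * n) choose n) / 4 ^ n)\<^sup>2 * (2 * real n + 1) \<le> 1"
  proof (induction n)
    case (Suc n)
    have "(real n + 1) * real ((2 * Suc n) choose Suc n) =
        2 * (2 * real n + 1) * real ((2 * n) choose n)"
      using arg_cong[OF central_binomial_Suc[of n], of real]
      unfolding of_nat_mult by (simp only: of_nat_Suc of_nat_mult of_nat_numeral add.commute)
    then have *: "real ((2 * Suc n) choose Suc n) =
        2 * (2 * real n + 1) * real ((2 * n) choose n) / (real n + 1)"
      by (simp only: field_simps)
    have "2 * u * x / v / (4 * w) = x / w * (u / (2 * v))" for u v w x :: real
      by (simp add: mult_ac)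
    then have r: "real ((2 * Suc n) choose Suc n) / 4 ^ Suc n =
        real ((2 * n) choose n) / 4 ^ n * ((2 * real n + 1) / (2 * (real n + 1)))"
      unfolding * power_Suc by blast
    have "(real ((2 * Suc n) choose Suc n) / 4 ^ Suc n)\<^sup>2 * (2 * real (Suc n) + 1) =
        (real ((2 * n) choose n) / 4 ^ n)\<^sup>2 * (2 * real n + 1) *
        ((2 * real n + 1) * (2 * real n + 3) / (2 * (real n + 1))\<^sup>2)"
      unfolding r by (simp add: power_mult_distrib power_divide power2_eq_square add_ac mult_ac)
    also have "\<dots> \<le> 1 * 1"
    proof (intro mult_mono Suc.IH)
      have "(2 * real n + 1) * (2 * real n + 3) \<le> (2 * (real n + 1))\<^sup>2"
        by (simp add: power2_eq_square algebra_simps)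
      then show "(2 * real n + 1) * (2 * real n + 3) / (2 * (real n + 1))\<^sup>2 \<le> 1"
        by (subst divide_le_eq_1_pos) simp_all
    qed simp_all
    finally show ?case by simp
  qed simp
  then have "(real ((2 * n) choose n) / 4 ^ n)\<^sup>2 \<le> (1 / sqrt (2 * real n + 1))\<^sup>2"
    by (simp add: power_divide field_simps)
  then show ?thesis
    by (rule power2_le_imp_le) simp
qed

text \<open>The middle coefficient dominates its row. In an odd row it is half the central
  coefficient of the next row, so both parities reduce to
  \<open>central_binomial_le\<close>.\<close>

lemma binomial_div_power_le: "real (k choose j) / 2 ^ k \<le> 1 / sqrt (real k + 1)"
proof -
  have "real (k choose (k div 2)) / 2 ^ k \<le> 1 / sqrt (real k + 1)"
  proof (cases "even k")
    case True
    then obtain n where "k = 2 * n" by blast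
    then show ?thesis using central_binomial_le[of n] by (simp add: power_mult)
  next
    case False
    then obtain n where k: "k = 2 * n + 1" by (auto elim: oddE)
    have "(2 * Suc n) choose Suc n = 2 * (k choose (k div 2))"
      using central_binomial_odd[of k] k by simp
    then have "real (k choose (k div 2)) / 2 ^ k = real ((2 * Suc n) choose Suc n) / 4 ^ Suc n"
      by (simp add: k power_mult)
    also have "\<dots> \<le> 1 / sqrt (2 * real (Suc n) + 1)"
      by (rule central_binomial_le)
    also have "\<dots> \<le> 1 / sqrt (real k + 1)"
      by (intro divide_left_mono) (simp_all add: k)
    finally show ?thesis .
  qed
  moreover have "real (k choose j) / 2 ^ k \<le> real (k choose (k div 2)) / 2 ^ k"
    by (intro divide_right_mono) (simp_all add: binomial_maximum)
  ultimately show ?thesis by linarith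
qed

section \<open>The simple random walk\<close>

text \<open>Ending at \<open>x\<close> after \<open>k\<close> steps takes \<open>(x + k) / 2\<close>
  steps to the right. The guard \<open>- int k \<le> x\<close> is there because \<open>nat\<close>
  sends negative numbers to 0, where the binomial coefficient is 1; beyond \<open>x = k\<close> the
  coefficient vanishes by itself.\<close>

lemma avg_pow_unit_mass:
  "(avg ^^ k) unit_mass x =
    (if even (x + int k) \<and> - int k \<le> x then real (k choose nat ((x + int k) div 2)) / 2 ^ k else 0)"
proof (induction k arbitrary: x)
  case 0
  show ?case by (auto simp: unit_mass_def binomial_eq_0_iff elim!: evenE)
next
  case (Suc k)
  show ?case
  proof (cases "even (x + int (Suc k))")
    case True
    then obtain j where j: "x = 2 * j - int (Suc k)"
      by (metis add_diff_cancel_right' evenE)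
    have x: "x + 1 + int k = 2 * j" "x - 1 + int k = 2 * (j - 1)" "x + int (Suc k) = 2 * j"
      using j by simp_all
    have "(avg ^^ Suc k) unit_mass x =
        ((if j \<ge> 0 then real (k choose nat j) / 2 ^ k else 0) +
         (if j \<ge> 1 then real (k choose nat (j - 1)) / 2 ^ k else 0)) / 2"
      using j by (simp add: avg_def Suc.IH x)
    also have "\<dots> = (if j \<ge> 0 then real (Suc k choose nat j) / 2 ^ Suc k else 0)"
    proof (cases "j \<ge> 1")
      case True
      then have "nat j = Suc (nat (j - 1))" by simp
      then show ?thesis using True by (simp add: add_divide_distrib)
    next
      case False
      then show ?thesis by (cases "j = 0") simp_all
    qed
    finally show ?thesis using j by (simp add: x(3))
  next
    case False
    then have "odd (x + 1 + int k)" "odd (x - 1 + int k)" by simp_all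
    then have "(avg ^^ k) unit_mass (x + 1) = 0" "(avg ^^ k) unit_mass (x - 1) = 0"
      by (simp_all only: Suc.IH) simp_all
    with False show ?thesis by (simp add: avg_def[of "(avg ^^ k) unit_mass"])
  qed
qed

lemma avg_pow_unit_mass_le: "\<bar>(avg ^^ k) unit_mass x\<bar> \<le> 1 / sqrt (real k + 1)"
  using binomial_div_power_le[of k] by (simp add: avg_pow_unit_mass)

section \<open>Negative moments of binomial weights\<close>

text \<open>Absorption, \<open>(n choose k) / (k + 1) = (Suc n choose Suc k) / (n + 1)\<close>,
  turns the sum into the expansion of \<open>(A + B) ^ Suc n\<close> without its nonnegative first
  term \<open>A ^ Suc n\<close>, divided by \<open>B * (n + 1)\<close>.\<close>

lemma binomial_average_inverse_Suc:
  fixes A B :: real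
  assumes "A \<ge> 0" "B > 0"
  shows "(\<Sum>k\<le>n. real (n choose k) * B ^ k * A ^ (n - k) * (1 / (real k + 1))) \<le>
    (A + B) ^ Suc n / (B * (real n + 1))"
proof -
  have term_eq: "real (n choose k) * B ^ k * A ^ (n - k) * (1 / (real k + 1)) =
      real (Suc n choose Suc k) * B ^ Suc k * A ^ (Suc n - Suc k) / (B * (real n + 1))" for k
  proof -
    have "(real n + 1) * real (n choose k) = real (Suc n choose Suc k) * (real k + 1)"
      using arg_cong[OF Suc_times_binomial_eq[of n k], of real]
      by (simp only: of_nat_mult of_nat_Suc add.commute)
    then have "real (n choose k) = real (Suc n choose Suc k) * (real k + 1) / (real n + 1)"
      by (simp only: field_simps)
    then show ?thesis
      using assms by (simp del: binomial_Suc_Suc)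
  qed
  have "(\<Sum>k\<le>n. real (Suc n choose Suc k) * B ^ Suc k * A ^ (Suc n - Suc k)) \<le>
      (\<Sum>k\<le>Suc n. real (Suc n choose k) * B ^ k * A ^ (Suc n - k))"
    unfolding sum.atMost_Suc_shift using assms by simp
  also have "\<dots> = (A + B) ^ Suc n"
    by (simp only: binomial_ring[of B A "Suc n"] add.commute[of A])
  finally show ?thesis
    unfolding term_eq sum_divide_distrib[symmetric] using assms by (intro divide_right_mono) simp_all
qed

lemma binomial_average_inverse_sqrt:
  fixes A B :: real
  assumes "A \<ge> 0" "B > 0"
  shows "(\<Sum>k\<le>n. real (n choose k) * B ^ k * A ^ (n - k) * (1 / sqrt (real k + 1))) \<le>
    ((A + B) / B + 1) / 2 * (A + B) ^ n / sqrt (real n + 1)"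
proof -
  let ?w = "\<lambda>k. real (n choose k) * B ^ k * A ^ (n - k)"
  define s where "s = sqrt (real n + 1)"
  \<comment> \<open>As weight in the AM-GM step below, \<open>s\<close> balances the two resulting
    terms: both become of order \<open>(A + B) ^ n / s\<close>.\<close>
  have s: "s > 0" "s * s = real n + 1" by (simp_all add: s_def)
  \<comment> \<open>AM-GM makes the square root linear in \<open>1 / (k + 1)\<close>, whose binomial average is explicit.\<close>
  have amgm: "1 / sqrt (real k + 1) \<le> s / 2 * (1 / (real k + 1)) + 1 / (2 * s)" for k
  proof -
    define u where "u = 1 / sqrt (real k + 1)"
    have "0 \<le> (s * u - 1)\<^sup>2 / (2 * s)" using s by simp
    also have "\<dots> = s / 2 * u\<^sup>2 - u + 1 / (2 * s)"
      using s(1) by (simp add: power2_eq_square field_simps)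
    also have "u\<^sup>2 = 1 / (real k + 1)" by (simp add: u_def power_divide)
    finally show ?thesis by (simp add: u_def)
  qed
  have "(\<Sum>k\<le>n. ?w k * (1 / sqrt (real k + 1))) \<le>
      (\<Sum>k\<le>n. ?w k * (s / 2 * (1 / (real k + 1)) + 1 / (2 * s)))"
    using assms by (intro sum_mono mult_left_mono amgm) simp
  also have "\<dots> = s / 2 * (\<Sum>k\<le>n. ?w k * (1 / (real k + 1))) + 1 / (2 * s) * (\<Sum>k\<le>n. ?w k)"
    by (simp add: sum_distrib_left sum.distrib algebra_simps)
  also have "(\<Sum>k\<le>n. ?w k) = (A + B) ^ n"
    by (simp add: binomial_ring[of B A n] add.commute[of A])
  also have "s / 2 * (\<Sum>k\<le>n. ?w k * (1 / (real k + 1))) + 1 / (2 * s) * (A + B) ^ n \<le>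
      s / 2 * ((A + B) ^ Suc n / (B * (s * s))) + 1 / (2 * s) * (A + B) ^ n"
    unfolding s(2) using s(1)
    by (intro add_right_mono mult_left_mono binomial_average_inverse_Suc assms) simp
  also have "\<dots> = ((A + B) / B + 1) / 2 * (A + B) ^ n / s"
    using s(1) assms by (simp add: field_simps)
  finally show ?thesis by (simp add: s_def)
qed

section \<open>Decay of the recursion\<close>

lemma corr_even_le:
  assumes "\<alpha> > 0" "\<beta> > 0"
  obtains D where "D \<ge> 0" "\<And>n i. \<bar>corr \<alpha> \<beta> (2 * n) i\<bar> \<le> D * (\<alpha> + \<beta>) ^ (2 * n) / sqrt (real n + 1)"
proof
  let ?A = "\<alpha>\<^sup>2 + \<beta>\<^sup>2" and ?B = "2 * \<alpha> * \<beta>"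
  \<comment> \<open>The weights of one block add up to \<open>(\<alpha> + \<beta>)\<^sup>2\<close>,
    which produces the decay rate.\<close>
  have AB: "?A + ?B = (\<alpha> + \<beta>)\<^sup>2" by (simp add: power2_sum)
  show "((\<alpha> + \<beta>)\<^sup>2 / ?B + 1) / 2 \<ge> 0" using assms by simp
  fix n i
  have "unit_mass = on_parity True unit_mass"
    by (auto simp: unit_mass_def on_parity_def)
  then have "\<bar>corr \<alpha> \<beta> (2 * n) i\<bar> = \<bar>(two_step \<alpha> \<beta> ^^ n) (on_parity True unit_mass) i\<bar>"
    by (simp add: corr_even)
  also have "\<dots> \<le> (\<Sum>k\<le>n. real (n choose k) * ?B ^ k * ?A ^ (n - k) * (1 / sqrt (real k + 1)))"
    using assms by (intro two_step_pow_bound avg_pow_unit_mass_le) simp_all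
  also have "\<dots> \<le> ((?A + ?B) / ?B + 1) / 2 * (?A + ?B) ^ n / sqrt (real n + 1)"
    using assms by (intro binomial_average_inverse_sqrt) simp_all
  finally show "\<bar>corr \<alpha> \<beta> (2 * n) i\<bar> \<le>
      ((\<alpha> + \<beta>)\<^sup>2 / ?B + 1) / 2 * (\<alpha> + \<beta>) ^ (2 * n) / sqrt (real n + 1)"
    by (simp only: AB power_mult)
qed

lemma corr_le:
  assumes "\<alpha> > 0" "\<beta> > 0"
  obtains D where "\<And>t i. t > 0 \<Longrightarrow> \<bar>corr \<alpha> \<beta> t i\<bar> \<le> D * ((\<alpha> + \<beta>) ^ t / sqrt (real t))"
proof -
  obtain D where D: "D \<ge> 0"
      "\<And>n i. \<bar>corr \<alpha> \<beta> (2 * n) i\<bar> \<le> D * (\<alpha> + \<beta>) ^ (2 * n) / sqrt (real n + 1)"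
    using corr_even_le[OF assms] by metis
  \<comment> \<open>An odd time costs one more step, of total weight
    \<open>\<alpha> + \<beta>\<close>; the factor \<open>sqrt 2\<close> pays for replacing
    \<open>n + 1\<close> by \<open>t\<close>, as \<open>t \<le> 2 * (n + 1)\<close>.\<close>
  have "\<bar>corr \<alpha> \<beta> t i\<bar> \<le> D * sqrt 2 * ((\<alpha> + \<beta>) ^ t / sqrt (real t))" if "t > 0" for t i
  proof -
    define n where "n = t div 2"
    have "\<bar>corr \<alpha> \<beta> t i\<bar> \<le> D * (\<alpha> + \<beta>) ^ t / sqrt (real n + 1)"
    proof (cases "even t")
      case True
      then show ?thesis using D(2)[of n i] by (simp add: n_def)
    next
      case False
      then have t: "t = Suc (2 * n)" by (simp add: n_def)
      have "\<bar>corr \<alpha> \<beta> t i\<bar> \<le>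
          \<alpha> * \<bar>corr \<alpha> \<beta> (2 * n) i\<bar> + \<beta> * \<bar>corr \<alpha> \<beta> (2 * n) (partner (2 * n) i)\<bar>"
        using assms unfolding t by (simp add: order.trans[OF abs_triangle_ineq] abs_mult)
      also have "\<dots> \<le> \<alpha> * (D * (\<alpha> + \<beta>) ^ (2 * n) / sqrt (real n + 1)) +
          \<beta> * (D * (\<alpha> + \<beta>) ^ (2 * n) / sqrt (real n + 1))"
        using assms by (intro add_mono mult_left_mono D(2)) simp_all
      also have "\<dots> = D * (\<alpha> + \<beta>) ^ t / sqrt (real n + 1)"
        by (simp add: t add_divide_distrib[symmetric] algebra_simps)
      finally show ?thesis .
    qed
    also have "\<dots> \<le> D * (\<alpha> + \<beta>) ^ t / (sqrt (real t) / sqrt 2)"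
    proof (rule divide_left_mono)
      have "t \<le> 2 * (n + 1)" unfolding n_def by presburger
      then have "real t \<le> real (2 * (n + 1))" by (simp only: of_nat_le_iff)
      then have "real t / 2 \<le> real n + 1" by simp
      then show "sqrt (real t) / sqrt 2 \<le> sqrt (real n + 1)"
        by (simp add: real_sqrt_divide[symmetric])
    qed (use assms D(1) that in simp_all)
    finally show ?thesis by (simp add: mult_ac)
  qed
  then show thesis by (rule that)
qed

lemma corr_bigo:
  assumes "\<beta> \<noteq> 0"
  shows "(\<lambda>t. corr \<alpha> \<beta> t i) \<in> O(\<lambda>t. (\<bar>\<alpha>\<bar> + \<bar>\<beta>\<bar>) ^ t / sqrt (real t))"
proof (cases "\<alpha> = 0")
  case True
  \<comment> \<open>All mass sits at site \<open>t\<close> at time \<open>t\<close>, so none is at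
    \<open>i\<close> once \<open>t > nat i\<close>; a negative \<open>i\<close> is never
    visited.\<close>
  have "eventually (\<lambda>t. corr \<alpha> \<beta> t i = 0) sequentially"
    using eventually_gt_at_top[of "nat i"] by eventually_elim (auto simp: True corr_pure_exchange)
  then show ?thesis
    by (simp add: landau_o.big.in_cong)
next
  case False
  then obtain D where D: "\<And>t i. t > 0 \<Longrightarrow>
      \<bar>corr \<bar>\<alpha>\<bar> \<bar>\<beta>\<bar> t i\<bar> \<le> D * ((\<bar>\<alpha>\<bar> + \<bar>\<beta>\<bar>) ^ t / sqrt (real t))"
    using corr_le[of "\<bar>\<alpha>\<bar>" "\<bar>\<beta>\<bar>"] assms by auto
  show ?thesis
  proof (rule bigoI[where c = D])
    show "eventually (\<lambda>t. norm (corr \<alpha> \<beta> t i) \<le>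
        D * norm ((\<bar>\<alpha>\<bar> + \<bar>\<beta>\<bar>) ^ t / sqrt (real t))) sequentially"
      using eventually_gt_at_top[of 0]
    proof eventually_elim
      case (elim t)
      show ?case
        using D[OF elim, of i] abs_corr_le[of \<alpha> \<beta> t i] by simp
    qed
  qed
qed

section \<open>Correlations of the Markov chain\<close>

context Ionescu_Tulcea
begin

text \<open>On an initial segment the cylinder embedding is the identity; the empty history before
  time 0 is \<open>\<lambda>_. undefined\<close>.\<close>

lemma CI_Ico: "CI {0..<n} = C 0 n (\<lambda>_. undefined)"
proof (rule measure_eqI)
  fix X assume "X \<in> sets (CI {0..<n})"
  then have X: "X \<in> sets (PiM {0..<n} M)" by (simp add: CI_def)
  then have "PF.emb {0..<n} {0..<n} X = X"
    using sets.sets_into_space[OF X] by (intro prod_emb_id) (simp add: space_PiM)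
  with X show "emeasure (CI {0..<n}) X = emeasure (C 0 n (\<lambda>_. undefined)) X"
    by (simp add: emeasure_CI[where n = n])
qed (simp add: CI_def sets_C)

lemma integral_lim_restrict:
  fixes f :: "(nat \<Rightarrow> 'a) \<Rightarrow> real"
  assumes "f \<in> borel_measurable (PiM {0..<n} M)"
  shows "(\<integral>h. f (restrict h {0..<n}) \<partial>PF.lim) = (\<integral>h. f h \<partial>C 0 n (\<lambda>_. undefined))"
proof -
  have "(\<lambda>h. restrict h {0..<n}) \<in> measurable PF.lim (PiM {0..<n} M)"
    by (simp add: measurable_cong_sets[OF PF.sets_lim refl] measurable_restrict_subset)
  then show ?thesis
    using integral_distr[of "\<lambda>h. restrict h {0..<n}" PF.lim "PiM {0..<n} M" f] assms
    by (simp add: distr_lim CI_Ico)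
qed

text \<open>Tower property. A function of the first coordinates is integrated under the finite-time
  law \<open>C\<close>, whose last kernel enters by a bind and can be integrated first; boundedness
  supplies integrability.\<close>

lemma integral_lim_Suc:
  fixes f :: "(nat \<Rightarrow> 'a) \<Rightarrow> real"
  assumes f[measurable]: "f \<in> borel_measurable (PiM {0..<Suc n} M)"
    and bounded: "\<And>h. \<bar>f h\<bar> \<le> B"
  shows "(\<integral>h. f (restrict h {0..<Suc n}) \<partial>PF.lim) =
    (\<integral>h. (\<integral>x. f ((restrict h {0..<n})(n := x)) \<partial>P n (restrict h {0..<n})) \<partial>PF.lim)"
proof -
  let ?C = "C 0 n (\<lambda>_. undefined)"
  have sets_C0: "sets ?C = sets (PiM {0..<n} M)"
    using sets_C[of "\<lambda>_. undefined" 0 n] by simp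
  have eP: "eP n \<in> measurable ?C (subprob_algebra (PiM {0..<Suc n} M))"
    by (simp add: measurable_cong_sets[OF sets_C0 refl])
  have prob: "prob_space ?C" by (rule prob_space_C) simp
  \<comment> \<open>\<open>eP n h\<close> is the image of \<open>P n h\<close> under appending the
    new state to the history \<open>h\<close>.\<close>
  have int_eP: "(\<integral>x. f x \<partial>eP n h) = (\<integral>x. f (h(n := x)) \<partial>P n h)"
    if h: "h \<in> space (PiM {0..<n} M)" for h
  proof -
    have "fun_upd h n \<in> measurable (P n h) (PiM {0..<Suc n} M)"
      using h by (auto intro!: measurable_fun_upd[where J = "{0..<n}"])
    then show ?thesis unfolding eP_def by (rule integral_distr) (rule f)
  qed
  have meas: "(\<lambda>h. \<integral>x. f x \<partial>eP n h) \<in> borel_measurable (PiM {0..<n} M)"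
    by (rule measurable_compose[OF measurable_eP integral_measurable_subprob_algebra[OF f]])
  have "(\<integral>h. f (restrict h {0..<Suc n}) \<partial>PF.lim) = (\<integral>h. f h \<partial>C 0 (Suc n) (\<lambda>_. undefined))"
    by (rule integral_lim_restrict) (rule f)
  also have "\<dots> = (\<integral>h. (\<integral>x. f x \<partial>eP n h) \<partial>?C)"
    unfolding C.simps add_0
  proof (rule integral_bind[where B = B and B' = 1 and K = "PiM {0..<Suc n} M"])
    show "AE h in ?C. emeasure (eP n h) (space (eP n h)) \<le> ennreal 1"
      using prob_space.emeasure_space_1[OF prob_space_eP[of _ n]] sets_eq_imp_space_eq[OF sets_C0]
      by (intro AE_I2) simp
  qed (use bounded eP prob in \<open>auto intro: prob_space.finite_measure\<close>)
  also have "\<dots> = (\<integral>h. (\<integral>x. f x \<partial>eP n (restrict h {0..<n})) \<partial>PF.lim)"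
    by (rule integral_lim_restrict[symmetric, OF meas])
  also have "\<dots> = (\<integral>h. (\<integral>x. f ((restrict h {0..<n})(n := x)) \<partial>P n (restrict h {0..<n})) \<partial>PF.lim)"
    by (intro Bochner_Integration.integral_cong refl int_eP)
      (simp add: PF.space_lim space_PiM PiE_iff)
  finally show ?thesis .
qed

end

section \<open>Conditional means of spins\<close>

definition spin :: "bool \<Rightarrow> real" where
  "spin x = (if x then 1 else - 1)"

lemma abs_spin: "\<bar>spin x\<bar> = 1" and spin_square: "spin x * spin x = 1"
  by (simp_all add: spin_def)

lemma edge_eq_spin: "edge i t e = (1 + spin (e (i, t))) / 2"
  by (simp add: edge_def spin_def)

text \<open>Equal entries give mean \<open>(2 * r - 1) * spin x\<close>, unequal ones
  \<open>(1 - 2 * p) * spin x\<close>. As \<open>spin y\<close> is \<open>spin x\<close> or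
  \<open>- spin x\<close> accordingly, the coefficients must have sum \<open>2 * r - 1\<close> and
  difference \<open>1 - 2 * p\<close>.\<close>

lemma integral_spin_pair_step:
  assumes "0 \<le> p" "p \<le> 1" "0 \<le> r" "r \<le> 1"
  shows "(\<integral>z. spin (fst z) \<partial>pair_step p r x y) = (r - p) * spin x + (r + p - 1) * spin y"
    and "(\<integral>z. spin (snd z) \<partial>pair_step p r x y) = (r - p) * spin y + (r + p - 1) * spin x"
  using assms by (auto simp: pair_step_def spin_def algebra_simps)

lemma integral_spin_line_step:
  assumes "0 \<le> p" "p \<le> 1" "0 \<le> r" "r \<le> 1"
  shows "(\<integral>\<xi>. spin (\<xi> i) \<partial>line_step p r t \<eta>) =
    (r - p) * spin (\<eta> i) + (r + p - 1) * spin (\<eta> (partner t i))"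
proof -
  define I where "I = {i. even (i + int t)}"
  define K where "K = (\<lambda>i. measure_pmf (pair_step p r (\<eta> i) (\<eta> (i + 1))))"
  let ?out = "\<lambda>\<omega> i. if even (i + int t) then fst (\<omega> i) else snd (\<omega> (i - 1)) :: bool"
  have comp: "(\<lambda>\<omega>. \<omega> j) \<in> measurable (PiM I K) (count_space UNIV)" if "j \<in> I" for j
    using measurable_component_singleton[OF that, of K] by (simp add: K_def)
  have out_i: "(\<lambda>\<omega>. ?out \<omega> i) \<in> measurable (PiM I K) (count_space UNIV)" for i
  proof (cases "even (i + int t)")
    case True
    then show ?thesis using measurable_compose[OF comp[of i], of fst] by (simp add: I_def)
  next
    case False
    then show ?thesis using measurable_compose[OF comp[of "i - 1"], of snd] by (simp add: I_def)
  qed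
  then have out: "?out \<in> measurable (PiM I K) line_space"
    by (intro measurable_PiM_single') auto
  \<comment> \<open>Each site of the new line reads a single coordinate of the product over pairs,
    so one-coordinate marginals suffice.\<close>
  have marginal: "(\<integral>\<omega>. g (\<omega> j) \<partial>PiM I K) = (\<integral>z. g z \<partial>K j)" if j: "j \<in> I"
    for g :: "bool \<times> bool \<Rightarrow> real" and j
  proof -
    have "K j = distr (PiM I K) (K j) (\<lambda>\<omega>. \<omega> j)"
      using j by (intro distr_PiM_component[symmetric]) (simp_all add: K_def prob_space_measure_pmf)
    then have "(\<integral>z. g z \<partial>K j) = (\<integral>z. g z \<partial>distr (PiM I K) (K j) (\<lambda>\<omega>. \<omega> j))"
      by simp
    also have "\<dots> = (\<integral>\<omega>. g (\<omega> j) \<partial>PiM I K)"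
      using j by (intro integral_distr) (simp_all add: K_def)
    finally show ?thesis by simp
  qed
  have "(\<integral>\<xi>. spin (\<xi> i) \<partial>line_step p r t \<eta>) = (\<integral>\<omega>. spin (?out \<omega> i) \<partial>PiM I K)"
    unfolding line_step_def K_def[symmetric] I_def[symmetric]
    by (intro integral_distr[OF out]) simp
  also have "\<dots> = (r - p) * spin (\<eta> i) + (r + p - 1) * spin (\<eta> (partner t i))"
  proof (cases "even (i + int t)")
    case True
    then have "(\<integral>\<omega>. spin (?out \<omega> i) \<partial>PiM I K) = (\<integral>z. spin (fst z) \<partial>K i)"
      using marginal[of i "\<lambda>z. spin (fst z)"] by (simp add: I_def)
    with True show ?thesis
      by (simp add: K_def integral_spin_pair_step[OF assms] partner_def)
  next
    case False
    then have "(\<integral>\<omega>. spin (?out \<omega> i) \<partial>PiM I K) = (\<integral>z. spin (snd z) \<partial>K (i - 1))"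
      using marginal[of "i - 1" "\<lambda>z. spin (snd z)"] by (simp add: I_def)
    with False show ?thesis
      by (simp add: K_def integral_spin_pair_step[OF assms] partner_def)
  qed
  finally show ?thesis .
qed

lemma integral_chain_law_0:
  fixes \<phi> :: "(int \<Rightarrow> bool) \<Rightarrow> real"
  assumes "\<mu> \<in> space (prob_algebra line_space)" and "\<phi> \<in> borel_measurable line_space"
    and "\<And>\<eta>. \<bar>\<phi> \<eta>\<bar> \<le> B"
  shows "(\<integral>h. \<phi> (h 0) \<partial>chain_law \<mu> p r) = (\<integral>\<eta>. \<phi> \<eta> \<partial>\<mu>)"
proof -
  interpret IT: Ionescu_Tulcea "chain_kernel \<mu> p r" "\<lambda>_. line_space"
    by (rule Ionescu_Tulcea_chain_kernel[OF assms(1)])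
  interpret prob_space "chain_law \<mu> p r" by (rule prob_space_chain_law[OF assms(1)])
  have "(\<lambda>h. \<phi> (h 0)) \<in> borel_measurable (PiM {0..<Suc 0} (\<lambda>_. line_space))"
    by (rule measurable_compose[OF _ assms(2)]) (rule measurable_component_singleton, simp)
  from IT.integral_lim_Suc[OF this assms(3)]
  have "(\<integral>h. \<phi> (h 0) \<partial>chain_law \<mu> p r) = (\<integral>h. (\<integral>\<eta>. \<phi> \<eta> \<partial>\<mu>) \<partial>chain_law \<mu> p r)"
    by (simp add: chain_law_def chain_kernel_def)
  then show ?thesis by (simp add: prob_space)
qed

lemma integral_chain_law_Suc:
  fixes \<phi> \<psi> :: "(int \<Rightarrow> bool) \<Rightarrow> real"
  assumes "\<mu> \<in> space (prob_algebra line_space)"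
    and "\<phi> \<in> borel_measurable line_space" and "\<psi> \<in> borel_measurable line_space"
    and "\<And>\<eta>. \<bar>\<phi> \<eta>\<bar> \<le> 1" and "\<And>\<eta>. \<bar>\<psi> \<eta>\<bar> \<le> 1"
  shows "(\<integral>h. \<phi> (h 0) * \<psi> (h (Suc t)) \<partial>chain_law \<mu> p r) =
    (\<integral>h. \<phi> (h 0) * (\<integral>\<xi>. \<psi> \<xi> \<partial>line_step p r t (h t)) \<partial>chain_law \<mu> p r)"
proof -
  interpret IT: Ionescu_Tulcea "chain_kernel \<mu> p r" "\<lambda>_. line_space"
    by (rule Ionescu_Tulcea_chain_kernel[OF assms(1)])
  have component: "(\<lambda>h. h s) \<in> measurable (PiM {0..<Suc (Suc t)} (\<lambda>_. line_space)) line_space"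
    if "s < Suc (Suc t)" for s
    by (rule measurable_component_singleton) (simp add: that)
  have "(\<lambda>h. \<phi> (h 0) * \<psi> (h (Suc t))) \<in>
      borel_measurable (PiM {0..<Suc (Suc t)} (\<lambda>_. line_space))"
    by (intro borel_measurable_times measurable_compose[OF component assms(2)]
        measurable_compose[OF component assms(3)]) simp_all
  moreover have "\<bar>\<phi> (h 0) * \<psi> (h (Suc t))\<bar> \<le> 1" for h
    using mult_mono[OF assms(4,5)] by (simp add: abs_mult)
  ultimately show ?thesis
    using IT.integral_lim_Suc[of "\<lambda>h. \<phi> (h 0) * \<psi> (h (Suc t))" "Suc t" 1]
    by (simp add: chain_law_def chain_kernel_def)
qed

lemma sets_chain_law:
  assumes "\<mu> \<in> space (prob_algebra line_space)"
  shows "sets (chain_law \<mu> p r) = sets (PiM UNIV (\<lambda>_. line_space))"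
proof -
  interpret IT: Ionescu_Tulcea "chain_kernel \<mu> p r" "\<lambda>_. line_space"
    by (rule Ionescu_Tulcea_chain_kernel[OF assms])
  show ?thesis unfolding chain_law_def by (rule IT.PF.sets_lim)
qed

lemma measurable_chain_spin:
  assumes "\<mu> \<in> space (prob_algebra line_space)"
  shows "(\<lambda>h. spin (h t i)) \<in> borel_measurable (chain_law \<mu> p r)"
proof -
  have "(\<lambda>h. h t) \<in> measurable (PiM UNIV (\<lambda>_::nat. line_space)) line_space"
    by (rule measurable_component_singleton) simp
  then have "(\<lambda>h. h t i) \<in> measurable (PiM UNIV (\<lambda>_::nat. line_space)) (count_space UNIV)"
    by (rule measurable_compose) (rule measurable_component_singleton, simp)
  then have "(\<lambda>h. spin (h t i)) \<in> borel_measurable (PiM UNIV (\<lambda>_::nat. line_space))"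
    by (rule measurable_compose) simp
  then show ?thesis by (simp add: measurable_cong_sets[OF sets_chain_law[OF assms] refl])
qed

text \<open>\<open>\<phi>\<close> is general in order to serve twice:
  \<open>\<phi> \<eta> = 1\<close> yields the means, \<open>\<phi> \<eta> = spin (\<eta> 0)\<close>
  the correlations with the origin.\<close>

lemma integral_chain_spin_Suc:
  fixes \<phi> :: "(int \<Rightarrow> bool) \<Rightarrow> real"
  assumes "0 \<le> p" "p \<le> 1" "0 \<le> r" "r \<le> 1" and \<mu>: "\<mu> \<in> space (prob_algebra line_space)"
    and \<phi>: "\<phi> \<in> borel_measurable line_space" "\<And>\<eta>. \<bar>\<phi> \<eta>\<bar> \<le> 1"
  shows "(\<integral>h. \<phi> (h 0) * spin (h (Suc t) i) \<partial>chain_law \<mu> p r) =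
    (r - p) * (\<integral>h. \<phi> (h 0) * spin (h t i) \<partial>chain_law \<mu> p r) +
    (r + p - 1) * (\<integral>h. \<phi> (h 0) * spin (h t (partner t i)) \<partial>chain_law \<mu> p r)"
proof -
  interpret prob_space "chain_law \<mu> p r" by (rule prob_space_chain_law[OF \<mu>])
  have "(\<lambda>h. h 0) \<in> measurable (chain_law \<mu> p r) line_space"
    by (simp add: measurable_cong_sets[OF sets_chain_law[OF \<mu>] refl] measurable_component_singleton)
  then have "(\<lambda>h. \<phi> (h 0)) \<in> borel_measurable (chain_law \<mu> p r)"
    by (rule measurable_compose) (rule \<phi>)
  then have int: "integrable (chain_law \<mu> p r) (\<lambda>h. \<phi> (h 0) * spin (h t j))" for j
    using \<phi>(2) by (intro integrable_const_bound[where B = 1] borel_measurable_times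
        measurable_chain_spin \<mu>) (simp_all add: abs_mult abs_spin)
  have "(\<integral>h. \<phi> (h 0) * spin (h (Suc t) i) \<partial>chain_law \<mu> p r) =
      (\<integral>h. \<phi> (h 0) * ((r - p) * spin (h t i) + (r + p - 1) * spin (h t (partner t i)))
        \<partial>chain_law \<mu> p r)"
    using integral_chain_law_Suc[OF \<mu> \<phi>(1) _ \<phi>(2), of "\<lambda>\<eta>. spin (\<eta> i)"]
    by (simp add: abs_spin integral_spin_line_step[OF assms(1-4)])
  also have "\<dots> = (\<integral>h. (r - p) * (\<phi> (h 0) * spin (h t i)) +
      (r + p - 1) * (\<phi> (h 0) * spin (h t (partner t i))) \<partial>chain_law \<mu> p r)"
    by (simp add: algebra_simps)
  finally show ?thesis using int by simp
qed

section \<open>Spins on the initial line and their evolution\<close>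

text \<open>The factors are independent and centred. Singletons \<open>J\<close> give the means, and
  \<open>{0, i}\<close> gives the correlations.\<close>

lemma integral_prod_spin_PM:
  assumes "finite J" "J \<noteq> {}"
  shows "(\<integral>\<eta>. (\<Prod>j\<in>J. spin (\<eta> j)) \<partial>PM (1 / 2)) = 0"
proof -
  let ?B = "\<lambda>_::int. measure_pmf (bernoulli_pmf (1 / 2))"
  interpret product_prob_space ?B UNIV
    by unfold_locales
  have "(\<integral>\<eta>. (\<Prod>j\<in>J. spin (\<eta> j)) \<partial>PM (1 / 2)) =
      (\<integral>\<eta>. (\<Prod>j\<in>J. spin (restrict \<eta> J j)) \<partial>PiM UNIV ?B)"
    by (simp add: PM_def)
  also have "\<dots> = (\<integral>\<eta>. (\<Prod>j\<in>J. spin (\<eta> j)) \<partial>distr (PiM UNIV ?B) (PiM J ?B) (\<lambda>\<eta>. restrict \<eta> J))"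
  proof (rule integral_distr[symmetric])
    show "(\<lambda>\<eta>. restrict \<eta> J) \<in> measurable (PiM UNIV ?B) (PiM J ?B)"
      by (rule measurable_restrict_subset) simp
    show "(\<lambda>\<eta>. \<Prod>j\<in>J. spin (\<eta> j)) \<in> borel_measurable (PiM J ?B)"
      by (intro borel_measurable_prod measurable_compose[OF measurable_component_singleton]) simp_all
  qed
  also have "\<dots> = (\<integral>\<eta>. (\<Prod>j\<in>J. spin (\<eta> j)) \<partial>PiM J ?B)"
    using assms(1) by (subst distr_PiM_restrict_finite) simp_all
  also have "\<dots> = (\<Prod>j\<in>J. \<integral>x. spin x \<partial>bernoulli_pmf (1 / 2))"
    using assms(1)
    by (intro product_integral_prod) (auto intro!: measure_pmf.integrable_const_bound[where B = 1] simp: abs_spin)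
  also have "\<dots> = 0"
    using assms by (simp add: spin_def card_gt_0_iff)
  finally show ?thesis .
qed

lemma integral_spin_PM: "(\<integral>\<eta>. spin (\<eta> i) \<partial>PM (1 / 2)) = 0"
  using integral_prod_spin_PM[of "{i}"] by simp

lemma integral_spin_mult_PM: "(\<integral>\<eta>. spin (\<eta> 0) * spin (\<eta> i) \<partial>PM (1 / 2)) = unit_mass i"
proof (cases "i = 0")
  case True
  have "prob_space (PM (1 / 2))"
    using PM_in_prob_algebra by (simp add: space_prob_algebra)
  with True show ?thesis by (simp add: spin_square unit_mass_def prob_space.prob_space)
next
  case False
  then show ?thesis using integral_prod_spin_PM[of "{0, i}"] by (simp add: unit_mass_def)
qed

lemma integral_chain_spin:
  assumes "0 \<le> p" "p \<le> 1" "0 \<le> r" "r \<le> 1"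
  shows "(\<integral>h. spin (h t i) \<partial>chain_law (PM (1 / 2)) p r) = 0"
proof (induction t arbitrary: i)
  case 0
  show ?case
    using integral_chain_law_0[OF PM_in_prob_algebra, of "\<lambda>\<eta>. spin (\<eta> i)" 1]
    by (simp add: abs_spin integral_spin_PM)
next
  case (Suc t)
  then show ?case
    using integral_chain_spin_Suc[OF assms PM_in_prob_algebra, of "\<lambda>_. 1"] by simp
qed

lemma integral_chain_spin_mult:
  assumes "0 \<le> p" "p \<le> 1" "0 \<le> r" "r \<le> 1"
  shows "(\<integral>h. spin (h 0 0) * spin (h t i) \<partial>chain_law (PM (1 / 2)) p r) =
    corr (r - p) (r + p - 1) t i"
proof (induction t arbitrary: i)
  case 0
  show ?case
    using integral_chain_law_0[OF PM_in_prob_algebra, of "\<lambda>\<eta>. spin (\<eta> 0) * spin (\<eta> i)" 1]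
    by (simp add: abs_mult abs_spin integral_spin_mult_PM)
next
  case (Suc t)
  then show ?case
    using integral_chain_spin_Suc[OF assms PM_in_prob_algebra, of "\<lambda>\<eta>. spin (\<eta> 0)"]
    by (simp add: abs_spin)
qed

section \<open>From spins to the edge correlation function\<close>

lemma measurable_field_of_chain:
  assumes "\<mu> \<in> space (prob_algebra line_space)"
  shows "(\<lambda>h (i, t). h t i) \<in> measurable (chain_law \<mu> p r) field_space"
proof -
  have "(\<lambda>h (i, t). h t i) \<in> measurable (PiM UNIV (\<lambda>_::nat. line_space)) field_space"
  proof (rule measurable_PiM_single')
    fix it :: "int \<times> nat"
    obtain i t where it: "it = (i, t)"
      by fastforce
    have "(\<lambda>h. h t) \<in> measurable (PiM UNIV (\<lambda>_::nat. line_space)) line_space"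
      by (rule measurable_component_singleton) simp
    then have "(\<lambda>h. h t i) \<in> measurable (PiM UNIV (\<lambda>_::nat. line_space)) (count_space UNIV)"
      by (rule measurable_compose) (rule measurable_component_singleton, simp)
    then show "(\<lambda>h. case it of (i, t) \<Rightarrow> h t i) \<in>
        measurable (PiM UNIV (\<lambda>_::nat. line_space)) (count_space UNIV)"
      by (simp add: it)
  qed auto
  then show ?thesis
    by (simp add: measurable_cong_sets[OF sets_chain_law[OF assms] refl])
qed

text \<open>An edge is \<open>(1 + spin) / 2\<close> with a centred spin of square 1, so both
  variances are 1/4 and the covariance is a quarter of the spin correlation; the normalisation
  cancels this factor.\<close>

lemma C8_eq_corr:
  fixes a b c d :: real
  defines "p \<equiv> a / (a + c)" and "r \<equiv> b / (b + d)"
  assumes "0 \<le> p" "p \<le> 1" "0 \<le> r" "r \<le> 1"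
  shows "C8 a b c d i t = corr (r - p) (r + p - 1) t i"
proof -
  let ?P = "P8 a b c d"
  interpret prob_space ?P by (rule prob_space_P8)
  have spin_meas: "(\<lambda>e. spin (e x)) \<in> borel_measurable field_space" for x :: "int \<times> nat"
    by (rule measurable_compose[OF measurable_component_singleton]) simp_all
  have spin_int: "(\<integral>e. spin (e (i, t)) \<partial>?P) = 0" for i t
    unfolding P8_def field_law_def p_def[symmetric] r_def[symmetric]
    by (subst integral_distr[OF measurable_field_of_chain[OF PM_in_prob_algebra] spin_meas])
      (simp add: integral_chain_spin[OF assms(3-6)])
  have spin_mult_int: "(\<integral>e. spin (e (0, 0)) * spin (e (i, t)) \<partial>?P) = corr (r - p) (r + p - 1) t i"
    unfolding P8_def field_law_def p_def[symmetric] r_def[symmetric]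
    by (subst integral_distr[OF measurable_field_of_chain[OF PM_in_prob_algebra]
          borel_measurable_times[OF spin_meas spin_meas]])
      (simp add: integral_chain_spin_mult[OF assms(3-6)])
  have "(\<lambda>e. spin (e x)) \<in> borel_measurable ?P" for x
    using spin_meas by (simp add: P8_def field_law_def)
  then have integrable: "integrable ?P (\<lambda>e. spin (e x))" for x
    by (intro integrable_const_bound[where B = 1]) (simp_all add: abs_spin)
  have mean: "expectation (edge i t) = 1 / 2" for i t
    using integrable by (simp add: edge_eq_spin[abs_def] spin_int prob_space)
  have centered: "edge i t e - 1 / 2 = spin (e (i, t)) / 2" for i t e
    by (simp add: edge_eq_spin field_simps)
  have variance: "variance (edge i t) = 1 / 4" for i t
    by (simp add: mean centered power2_eq_square spin_square prob_space)
  have "covariance ?P (edge 0 0) (edge i t) = corr (r - p) (r + p - 1) t i / 4"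
    by (simp add: covariance_def mean centered spin_mult_int)
  then show ?thesis
    unfolding C8_def variance by simp
qed

theorem theorem1p12:
  fixes a b c d p r :: real and i :: int
  assumes "a \<ge> 0" "b \<ge> 0" "c \<ge> 0" "d \<ge> 0"
    and "\<not> (a = 0 \<and> b = 0 \<and> c = 0 \<and> d = 0)"
    and "a + c = b + d"
    and "p = a / (a + c)" and "r = b / (b + d)"
  shows "(a = d \<and> b = c \<longleftrightarrow> p + r = 1) \<and>
    (a = d \<and> b = c \<longrightarrow>
      (\<forall>t. (i \<noteq> 0 \<longrightarrow> C8 a b c d i t = 0) \<and> C8 a b c d 0 t = (1 - 2 * p) ^ t)) \<and>
    (\<not> (a = d \<and> b = c) \<longrightarrow>
      (\<lambda>t. C8 a b c d i t) \<in> O(\<lambda>t. decay_rate p r ^ t / sqrt (real t)))"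
proof -
  define \<alpha> \<beta> where "\<alpha> = r - p" and "\<beta> = r + p - 1"
  have pos: "a + c > 0"
    using assms(1-6) by linarith
  have p: "0 \<le> p" "p \<le> 1" and r: "0 \<le> r" "r \<le> 1"
    using assms(1-4,6-8) pos by simp_all
  \<comment> \<open>As the two denominators agree, \<open>p + r = 1\<close> says
    \<open>b = c\<close>, and then \<open>a + c = b + d\<close> gives \<open>a = d\<close>.\<close>
  have "p + r = (a + b) / (a + c)"
    using assms(6-8) by (simp add: add_divide_distrib)
  then have iff: "a = d \<and> b = c \<longleftrightarrow> p + r = 1"
    using pos assms(6) by auto
  have C8: "C8 a b c d j t = corr \<alpha> \<beta> t j" for j t
    using C8_eq_corr[of a c b d j t] p r unfolding assms(7,8) \<alpha>_def \<beta>_def by blast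
  have "(i \<noteq> 0 \<longrightarrow> C8 a b c d i t = 0) \<and> C8 a b c d 0 t = (1 - 2 * p) ^ t" if "p + r = 1" for t
  proof -
    have "\<alpha> = 1 - 2 * p" "\<beta> = 0"
      using that by (simp_all add: \<alpha>_def \<beta>_def)
    then show ?thesis by (simp add: C8 corr_no_exchange)
  qed
  moreover have "(\<lambda>t. C8 a b c d i t) \<in> O(\<lambda>t. decay_rate p r ^ t / sqrt (real t))" if "p + r \<noteq> 1"
  proof -
    have "\<beta> \<noteq> 0" using that by (simp add: \<beta>_def)
    \<comment> \<open>\<open>1 - 2 * p\<close> is \<open>\<alpha> - \<beta>\<close> and
      \<open>1 - 2 * r\<close> is \<open>- (\<alpha> + \<beta>)\<close>; the larger absolute value
      of a sum and a difference is the sum of the absolute values.\<close>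
    moreover have "decay_rate p r = \<bar>\<alpha>\<bar> + \<bar>\<beta>\<bar>"
      by (auto simp: decay_rate_def \<alpha>_def \<beta>_def max_def abs_if)
    ultimately show ?thesis using corr_bigo by (simp add: C8)
  qed
  ultimately show ?thesis using iff by blast
qed

end
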